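(* Let $R$ be a convex quadrilateral in the $xy$-plane which is not a trapezoid. Then there is a unique ellipse $E_O$ of minimal eccentricity among all ellipses which pass through the four vertices of $R$.
   Context: Ellipses are nondegenerate and include circles. If an ellipse has semi-major axis length $a$ and semi-minor axis length $b$ ($a\ge b>0$), its eccentricity is $\sqrt{1-b^2/a^2}$. A trapezoid is a convex quadrilateral with at least one pair of parallel sides (so parallelograms are trapezoids). "Of minimal eccentricity" means that the minimum of the eccentricity over all ellipses through the four vertices of $R$ is attained, and uniqueness means that it is attained by exactly one such ellipse. *)

theory Defs
  imports "HOL-Analysis.Analysis"
begin

(* A quadrilateral is the closed region it bounds; its vertices are its extreme points
   and its sides are its edges.  Four extreme points in the plane force the
   quadrilateral to be nondegenerate (no three vertices collinear). *)

definition vertices :: "(real^2) set \<Rightarrow> (real^2) set" where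
  "vertices R = {x. x extreme_point_of R}"

definition convex_quadrilateral :: "(real^2) set \<Rightarrow> bool" where
  "convex_quadrilateral R \<longleftrightarrow> polytope R \<and> card (vertices R) = 4"

(* Distinct sides never lie on a common line, so affine_parallel, which also holds
   for equal lines, amounts here to ordinary parallelism. *)
definition trapezoid :: "(real^2) set \<Rightarrow> bool" where
  "trapezoid R \<longleftrightarrow> convex_quadrilateral R \<and>
     (\<exists>F G. F edge_of R \<and> G edge_of R \<and> F \<noteq> G \<and>
            affine_parallel (affine hull F) (affine hull G))"

(* Ellipse with centre c, axes along the orthonormal pair u, v, and semi-major and
   semi-minor axis lengths a and b. *)
definition ellipse_with_semiaxes :: "(real^2) set \<Rightarrow> real \<Rightarrow> real \<Rightarrow> bool" where
  "ellipse_with_semiaxes E a b \<longleftrightarrow> a \<ge> b \<and> b > 0 \<and>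
     (\<exists>c u v. norm u = 1 \<and> norm v = 1 \<and> u \<bullet> v = 0 \<and>
        E = {p. (((p - c) \<bullet> u) / a)\<^sup>2 + (((p - c) \<bullet> v) / b)\<^sup>2 = 1})"

definition ellipse :: "(real^2) set \<Rightarrow> bool" where
  "ellipse E \<longleftrightarrow> (\<exists>a b. ellipse_with_semiaxes E a b)"

(* Meaningful for ellipses only; the description determines the value by
   ellipse_with_semiaxes_unique below. *)
definition eccentricity :: "(real^2) set \<Rightarrow> real" where
  "eccentricity E =
     (THE e. \<exists>a b. ellipse_with_semiaxes E a b \<and> e = sqrt (1 - b\<^sup>2 / a\<^sup>2))"

definition circumscribed_ellipses :: "(real^2) set \<Rightarrow> (real^2) set set" where
  "circumscribed_ellipses R = {E. ellipse E \<and> vertices R \<subseteq> E}"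

lemma norm_orthonormal_pair:
  fixes u v x :: "real^2"
  assumes "norm u = 1" "norm v = 1" "u \<bullet> v = 0"
  shows "(norm x)\<^sup>2 = (x \<bullet> u)\<^sup>2 + (x \<bullet> v)\<^sup>2"
proof -
  have ne: "u \<noteq> v" "u \<noteq> 0" "v \<noteq> 0"
    using assms by (auto simp: dot_square_norm)
  have po: "pairwise orthogonal {u, v}"
    using assms by (auto simp: pairwise_def orthogonal_def inner_commute)
  have ind: "independent {u, v}"
    using pairwise_orthogonal_independent[OF po] ne by auto
  have "span {u, v} = UNIV"
    using card_eq_dim[of "{u,v}" UNIV] ind ne by auto
  then have "x \<in> span {u, v}"
    by simp
  then obtain k where "x - k *\<^sub>R u \<in> span {v}"
    by (auto simp: span_insert)
  then obtain l where l: "x - k *\<^sub>R u = l *\<^sub>R v"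
    by (auto simp: span_singleton)
  have uu: "u \<bullet> u = 1" "v \<bullet> v = 1" "v \<bullet> u = 0"
    using assms by (auto simp: dot_square_norm inner_commute)
  have x: "x = k *\<^sub>R u + l *\<^sub>R v"
    using l by (simp add: algebra_simps)
  show ?thesis
    unfolding power2_norm_eq_inner x
    using uu assms(3) by (simp add: inner_add_left inner_add_right power2_eq_square)
qed

lemma ellipse_dist_bounds:
  fixes p c u v :: "real^2"
  assumes uv: "norm u = 1" "norm v = 1" "u \<bullet> v = 0" and ab: "b \<le> a" "0 < b"
    and p: "(((p - c) \<bullet> u) / a)\<^sup>2 + (((p - c) \<bullet> v) / b)\<^sup>2 = 1"
  shows "b \<le> norm (p - c)" "norm (p - c) \<le> a"
proof -
  define X where "X = ((p - c) \<bullet> u) / a"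
  define Y where "Y = ((p - c) \<bullet> v) / b"
  have eq: "X\<^sup>2 + Y\<^sup>2 = 1" using p by (simp add: X_def Y_def)
  have n: "(norm (p - c))\<^sup>2 = a\<^sup>2 * X\<^sup>2 + b\<^sup>2 * Y\<^sup>2"
    unfolding norm_orthonormal_pair[OF uv] X_def Y_def using ab
    by (simp add: power_divide)
  have le: "b\<^sup>2 \<le> a\<^sup>2" using ab by (intro power_mono) auto
  have "b\<^sup>2 * X\<^sup>2 \<le> a\<^sup>2 * X\<^sup>2" "b\<^sup>2 * Y\<^sup>2 \<le> a\<^sup>2 * Y\<^sup>2"
    using le by (auto intro: mult_right_mono)
  moreover have "b\<^sup>2 = b\<^sup>2 * X\<^sup>2 + b\<^sup>2 * Y\<^sup>2" "a\<^sup>2 = a\<^sup>2 * X\<^sup>2 + a\<^sup>2 * Y\<^sup>2"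
    using eq by (metis distrib_left mult.right_neutral)+
  ultimately have "b\<^sup>2 \<le> (norm (p - c))\<^sup>2" "(norm (p - c))\<^sup>2 \<le> a\<^sup>2"
    using n by linarith+
  then show "b \<le> norm (p - c)" "norm (p - c) \<le> a"
    using ab by (auto intro: power2_le_imp_le)
qed

lemma ellipse_with_semiaxes_unique:
  assumes "ellipse_with_semiaxes E a b" "ellipse_with_semiaxes E a' b'"
  shows "a = a' \<and> b = b'"
proof -
  obtain c u v where 1: "norm u = 1" "norm v = 1" "u \<bullet> v = 0" "b \<le> a" "0 < b"
    and E1: "E = {p. (((p - c) \<bullet> u) / a)\<^sup>2 + (((p - c) \<bullet> v) / b)\<^sup>2 = 1}"
    using assms(1) unfolding ellipse_with_semiaxes_def by blast
  obtain c' u' v' where 2: "norm u' = 1" "norm v' = 1" "u' \<bullet> v' = 0" "b' \<le> a'" "0 < b'"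
    and E2: "E = {p. (((p - c') \<bullet> u') / a')\<^sup>2 + (((p - c') \<bullet> v') / b')\<^sup>2 = 1}"
    using assms(2) unfolding ellipse_with_semiaxes_def by blast
  have uu: "u \<bullet> u = 1" "v \<bullet> v = 1" "u' \<bullet> u' = 1" "v' \<bullet> v' = 1" "v \<bullet> u = 0" "v' \<bullet> u' = 0"
    using 1 2 by (auto simp: dot_square_norm inner_commute)
  have ax1: "c + a *\<^sub>R u \<in> E" "c + b *\<^sub>R v \<in> E"
    unfolding E1 using 1 uu by simp_all
  have ax2: "c' + a' *\<^sub>R u' \<in> E" "c' + b' *\<^sub>R v' \<in> E"
    unfolding E2 using 2 uu by simp_all
  note ax = ax1 ax2
  have bd: "b \<le> norm (p - c)" "norm (p - c) \<le> a" if "p \<in> E" for p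
    using ellipse_dist_bounds[OF 1] that unfolding E1 by auto
  have bd': "b' \<le> norm (p - c')" "norm (p - c') \<le> a'" if "p \<in> E" for p
    using ellipse_dist_bounds[OF 2] that unfolding E2 by auto
  have refl1: "2 *\<^sub>R c - p \<in> E" if "p \<in> E" for p
  proof -
    have "2 *\<^sub>R c - p - c = - (p - c)" by (simp add: scaleR_2)
    then show ?thesis
      using that unfolding E1 mem_Collect_eq by (simp only: inner_minus_left minus_divide_left[symmetric] power2_minus)
  qed
  have refl2: "2 *\<^sub>R c' - p \<in> E" if "p \<in> E" for p
  proof -
    have "2 *\<^sub>R c' - p - c' = - (p - c')" by (simp add: scaleR_2)
    then show ?thesis
      using that unfolding E2 mem_Collect_eq by (simp only: inner_minus_left minus_divide_left[symmetric] power2_minus)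
  qed
  have trans: "c + a *\<^sub>R u + real n *\<^sub>R (2 *\<^sub>R (c' - c)) \<in> E" for n
  proof (induction n)
    case 0 then show ?case using ax by simp
  next
    case (Suc n)
    have "2 *\<^sub>R c' - (2 *\<^sub>R c - (c + a *\<^sub>R u + real n *\<^sub>R (2 *\<^sub>R (c' - c)))) \<in> E"
      using Suc refl1 refl2 by blast
    then show ?case by (simp add: algebra_simps)
  qed
  have "c' = c"
  proof (rule ccontr)
    assume "c' \<noteq> c"
    then have pos: "norm (2 *\<^sub>R (c' - c)) > 0" by simp
    obtain n where n: "2 * a < real n * norm (2 *\<^sub>R (c' - c))"
      using reals_Archimedean3[OF pos] by blast
    have "real n * norm (2 *\<^sub>R (c' - c)) = norm (real n *\<^sub>R (2 *\<^sub>R (c' - c)))"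
      by simp
    also have "\<dots> \<le> norm (a *\<^sub>R u + real n *\<^sub>R (2 *\<^sub>R (c' - c))) + norm (a *\<^sub>R u)"
      using norm_triangle_ineq4[of "a *\<^sub>R u + real n *\<^sub>R (2 *\<^sub>R (c' - c))" "a *\<^sub>R u"]
      by (simp only: add_diff_cancel_left')
    also have "\<dots> \<le> a + a"
      using bd(2)[OF trans[of n]] 1 by (intro add_mono) (simp_all add: add.assoc)
    finally show False using n by linarith
  qed
  then show ?thesis
    using bd(2)[OF ax(3)] bd(1)[OF ax(4)] bd'(2)[OF ax(1)] bd'(1)[OF ax(2)] 1 2 by simp
qed

lemma eccentricity_eq:
  assumes "ellipse_with_semiaxes E a b"
  shows "eccentricity E = sqrt (1 - b\<^sup>2 / a\<^sup>2)"
  unfolding eccentricity_def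
  using assms ellipse_with_semiaxes_unique by (intro the_equality) blast+

end

theory Submission
  imports Defs
begin

text \<open>
  Scale the equation of an ellipse so that its quadratic part has trace 2. It then reads
  \<open>x\<^sup>2 + y\<^sup>2 + w\<^sub>1 (x\<^sup>2 - y\<^sup>2) + 2 w\<^sub>2 x y + l \<bullet> p + k = 0\<close>, and the vector \<open>w\<close>, the shape of the
  conic, determines the eccentricity: the quadratic part has the eigenvalues
  \<open>1 - norm w\<close> and \<open>1 + norm w\<close>, so the conics of this form with \<open>norm w < 1\<close> and at least two
  points are exactly the ellipses, and their squared eccentricity
  \<open>1 - (1 - norm w) / (1 + norm w)\<close> is strictly increasing in \<open>norm w\<close>
  (\<open>ellipse_conic\<close>, \<open>ellipse_is_conic\<close>). Minimizing the eccentricity means minimizing \<open>norm w\<close>.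

  Passing through given points is a system of linear equations in \<open>w\<close>, \<open>l\<close> and \<open>k\<close>, so the shapes
  of the conics through the vertices form an affine subspace of the plane
  (\<open>affine_circumscribed_shapes\<close>). It has exactly one point closest to the origin. That point is the
  shape of an ellipse as soon as some ellipse passes through the vertices, because its norm is then
  also less than 1. A shape determines the conic, because the vertices are not collinear
  (\<open>conic_determined_by_shape\<close>).

  There is an ellipse through the vertices because the diagonals of a convex quadrilateral cross.
  In the oblique coordinates given by the diagonals, with the crossing point as the origin, the
  vertices lie in pairs on the axes, on opposite sides of the origin, and a conic without mixed term passes
  through them (\<open>ellipse_through_crossing_diagonals\<close>).
\<close>

section \<open>Conics of trace 2 and their shape\<close>

lemma inner_2: "(x::real^2) \<bullet> y = x$1 * y$1 + x$2 * y$2"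
  by (simp add: inner_vec_def sum_2)

lemma norm_sq_2: "(norm (x::real^2))\<^sup>2 = (x$1)\<^sup>2 + (x$2)\<^sup>2"
  unfolding power2_norm_eq_inner by (simp add: inner_2 power2_eq_square)

definition shape_form :: "real^2 \<Rightarrow> real^2 \<Rightarrow> real" where
  "shape_form w p = p \<bullet> p + w$1 * ((p$1)\<^sup>2 - (p$2)\<^sup>2) + 2 * w$2 * p$1 * p$2"

definition conic :: "real^2 \<Rightarrow> real^2 \<Rightarrow> real \<Rightarrow> (real^2) set" where
  "conic w l k = {p. shape_form w p + l \<bullet> p + k = 0}"

text \<open>
  For a unit vector \<open>u\<close>, the shape whose quadratic part is the degenerate form \<open>2 (p \<bullet> v)\<^sup>2\<close>, where
  the unit vector \<open>v\<close> is orthogonal to \<open>u\<close>. Multiples \<open>r *\<^sub>R axis_shape u\<close> with \<open>0 < r < 1\<close>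
  are the shapes of ellipses whose major axis is parallel to \<open>u\<close>.
\<close>
definition axis_shape :: "real^2 \<Rightarrow> real^2" where
  "axis_shape u = vector [(u$2)\<^sup>2 - (u$1)\<^sup>2, - 2 * u$1 * u$2]"

lemma norm_axis_shape:
  assumes "norm u = 1"
  shows "norm (axis_shape u) = 1"
proof -
  have "(u$1)\<^sup>2 + (u$2)\<^sup>2 = 1"
    using norm_sq_2[of u] assms by simp
  moreover have "(norm (axis_shape u))\<^sup>2 = ((u$1)\<^sup>2 + (u$2)\<^sup>2)\<^sup>2"
    unfolding norm_sq_2 axis_shape_def vector_2 by algebra
  ultimately have "(norm (axis_shape u))\<^sup>2 = 1\<^sup>2" by simp
  then show ?thesis
    by (metis norm_ge_zero power2_eq_imp_eq zero_le_one)
qed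

text \<open>
  This is what diagonalizes the quadratic part. Turning \<open>u\<close> by an angle turns
  \<open>axis_shape u\<close> by twice that angle, so \<open>u\<close> is found by halving the polar angle of \<open>w\<close>.
\<close>
lemma axis_exists:
  obtains u where "norm u = 1" "w = norm w *\<^sub>R axis_shape u"
proof -
  obtain r t where r: "w$1 = r * cos t" "w$2 = r * sin t"
    using polar_Ex by blast
  have "\<exists>r t. r \<ge> 0 \<and> w$1 = r * cos t \<and> w$2 = r * sin t"
  proof (cases "r \<ge> 0")
    case False
    then have "- r \<ge> 0 \<and> w$1 = - r * cos (t + pi) \<and> w$2 = - r * sin (t + pi)"
      using r by simp
    then show ?thesis by blast
  qed (use r in blast)
  then obtain r t where r: "r \<ge> 0" "w$1 = r * cos t" "w$2 = r * sin t"
    by blast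
  have "(norm w)\<^sup>2 = r\<^sup>2 * ((cos t)\<^sup>2 + (sin t)\<^sup>2)"
    unfolding norm_sq_2 r(2,3) by (simp only: distrib_left power_mult_distrib)
  then have nw: "norm w = r"
    using r(1) by simp
  define u :: "real^2" where "u = vector [- sin (t/2), cos (t/2)]"
  have u: "u$1 = - sin (t/2)" "u$2 = cos (t/2)"
    by (simp_all add: u_def)
  have "(norm u)\<^sup>2 = 1\<^sup>2"
    unfolding norm_sq_2 u by simp
  then have "norm u = 1"
    by (metis norm_ge_zero power2_eq_imp_eq zero_le_one)
  moreover have "axis_shape u = vector [cos t, sin t]"
    unfolding axis_shape_def u using cos_double[of "t/2"] sin_double[of "t/2"] by simp
  then have "w = norm w *\<^sub>R axis_shape u"
    by (simp add: vec_eq_iff forall_2 nw r)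
  ultimately show ?thesis using that by blast
qed

text \<open>
  The quadratic part differs from the multiple \<open>1 + r\<close> of the squared norm only along \<open>u\<close>. This
  form avoids a choice of a second axis.
\<close>
lemma shape_form_axis:
  assumes "norm u = 1"
  shows "shape_form (r *\<^sub>R axis_shape u) p = (1 + r) * (p \<bullet> p) - 2 * r * (p \<bullet> u)\<^sup>2"
proof -
  have "(u$1)\<^sup>2 + (u$2)\<^sup>2 = 1"
    using norm_sq_2[of u] assms by simp
  then show ?thesis
    unfolding shape_form_def axis_shape_def inner_2 vector_scaleR_component vector_2 real_scaleR_def
    by algebra
qed

lemma shape_form_semiaxes:
  assumes "norm u = 1" "norm v = 1" "u \<bullet> v = 0"
  shows "shape_form (r *\<^sub>R axis_shape u) p = (1 - r) * (p \<bullet> u)\<^sup>2 + (1 + r) * (p \<bullet> v)\<^sup>2"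
proof -
  have "p \<bullet> p = (p \<bullet> u)\<^sup>2 + (p \<bullet> v)\<^sup>2"
    using norm_orthonormal_pair[OF assms, of p] by (simp add: power2_norm_eq_inner)
  then show ?thesis
    unfolding shape_form_axis[OF assms(1)] by algebra
qed

text \<open>The smaller eigenvalue of the quadratic part is \<open>1 - norm w\<close>.\<close>
lemma shape_form_lower_bound: "(1 - norm w) * (p \<bullet> p) \<le> shape_form w p"
proof -
  obtain u where u: "norm u = 1" "w = norm w *\<^sub>R axis_shape u"
    by (rule axis_exists)
  have "\<bar>p \<bullet> u\<bar> \<le> norm p"
    using Cauchy_Schwarz_ineq2[of p u] u by simp
  then have "(p \<bullet> u)\<^sup>2 \<le> p \<bullet> p"
    by (metis power2_norm_eq_inner abs_norm_cancel abs_le_square_iff)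
  then have "2 * norm w * (p \<bullet> u)\<^sup>2 \<le> 2 * norm w * (p \<bullet> p)"
    by (intro mult_left_mono) auto
  moreover have "shape_form w p = (1 + norm w) * (p \<bullet> p) - 2 * norm w * (p \<bullet> u)\<^sup>2"
    using shape_form_axis[OF u(1), of "norm w" p] u(2) by simp
  ultimately show ?thesis by (simp add: algebra_simps)
qed

lemma shape_form_translate:
  "shape_form w (p - c) = shape_form w p
     + vector [- 2 * ((1 + w$1) * c$1 + w$2 * c$2), - 2 * (w$2 * c$1 + (1 - w$1) * c$2)] \<bullet> p
     + shape_form w c"
  unfolding shape_form_def inner_2 vector_2 by (simp add: algebra_simps power2_eq_square)

text \<open>
  Completing the square: the linear part \<open>l\<close> can be absorbed because the matrix of the quadratic
  part has the nonzero determinant \<open>1 - (norm w)\<^sup>2\<close>.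
\<close>
lemma conic_centre_exists:
  assumes "norm w < 1"
  obtains c h where "conic w l k = {p. shape_form w (p - c) = h}"
proof -
  define D where "D = 1 - (w$1)\<^sup>2 - (w$2)\<^sup>2"
  have "(norm w)\<^sup>2 < 1\<^sup>2"
    using assms by (intro power_strict_mono) auto
  then have D: "D \<noteq> 0"
    by (simp add: D_def norm_sq_2)
  \<comment> \<open>Cramer's rule for the system expressing that the linear part of the translated form is \<open>l\<close>.\<close>
  define c :: "real^2" where
    "c = vector [- ((1 - w$1) * l$1 - w$2 * l$2) / (2 * D), - ((1 + w$1) * l$2 - w$2 * l$1) / (2 * D)]"
  have c: "2 * D * c$1 = - ((1 - w$1) * l$1 - w$2 * l$2)"
    "2 * D * c$2 = - ((1 + w$1) * l$2 - w$2 * l$1)"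
    using D by (simp_all add: c_def)
  have "D * (- 2 * ((1 + w$1) * c$1 + w$2 * c$2)) = D * l$1"
    "D * (- 2 * (w$2 * c$1 + (1 - w$1) * c$2)) = D * l$2"
    using c D_def by algebra+
  then have "- 2 * ((1 + w$1) * c$1 + w$2 * c$2) = l$1"
    "- 2 * (w$2 * c$1 + (1 - w$1) * c$2) = l$2"
    using D by auto
  then have "vector [- 2 * ((1 + w$1) * c$1 + w$2 * c$2), - 2 * (w$2 * c$1 + (1 - w$1) * c$2)] = l"
    by (simp add: vec_eq_iff forall_2)
  then have "shape_form w (p - c) = shape_form w p + l \<bullet> p + shape_form w c" for p
    using shape_form_translate[of w p c] by simp
  then have "conic w l k = {p. shape_form w (p - c) = shape_form w c - k}"
    unfolding conic_def by auto
  then show ?thesis using that by blast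
qed

section \<open>Ellipses as conics of trace 2\<close>

lemma orthogonal_unit_vector:
  assumes "norm (u::real^2) = 1"
  obtains v where "norm v = 1" "u \<bullet> v = 0"
proof
  have "(norm (vector [- u$2, u$1] :: real^2))\<^sup>2 = (norm u)\<^sup>2"
    unfolding norm_sq_2 vector_2 by simp
  then show "norm (vector [- u$2, u$1] :: real^2) = 1"
    using assms by (metis norm_ge_zero power2_eq_imp_eq)
  show "u \<bullet> (vector [- u$2, u$1] :: real^2) = 0"
    unfolding inner_2 vector_2 by simp
qed

text \<open>
  The squared semiaxes of an ellipse are inversely proportional to the eigenvalues of its quadratic
  part, so \<open>b\<^sup>2 / a\<^sup>2 = (1 - norm w) / (1 + norm w)\<close>.
\<close>
definition shape_eccentricity :: "real^2 \<Rightarrow> real" where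
  "shape_eccentricity w = sqrt (2 * norm w / (1 + norm w))"

lemma shape_eccentricity_le_iff:
  "shape_eccentricity w \<le> shape_eccentricity w' \<longleftrightarrow> norm w \<le> norm w'"
proof -
  have "0 < 1 + norm w" "0 < 1 + norm w'"
    by (simp_all add: add_pos_nonneg)
  then show ?thesis
    unfolding shape_eccentricity_def real_sqrt_le_iff
    by (simp add: frac_le_eq divide_le_0_iff divide_simps algebra_simps)
qed

text \<open>
  A positive definite quadratic part leaves three possibilities: an ellipse, a single point or the
  empty set. Two distinct points on the conic exclude the last two.
\<close>
lemma ellipse_conic:
  assumes w: "norm w < 1" and pq: "p \<in> conic w l k" "q \<in> conic w l k" "p \<noteq> q"
  shows "ellipse (conic w l k) \<and> eccentricity (conic w l k) = shape_eccentricity w"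
proof -
  define r where "r = norm w"
  have r: "0 \<le> r" "r < 1" using w by (auto simp: r_def)
  obtain c h where C: "conic w l k = {p. shape_form w (p - c) = h}"
    using conic_centre_exists[OF w] .
  \<comment> \<open>A point other than the centre forces the level \<open>h\<close> to be positive.\<close>
  have "\<exists>s \<in> conic w l k. s \<noteq> c"
    using pq by (cases "p = c") auto
  then obtain s where s: "s \<noteq> c" "shape_form w (s - c) = h"
    unfolding C by blast
  have "0 < (1 - r) * ((s - c) \<bullet> (s - c))"
    using s r by simp
  also have "\<dots> \<le> h"
    using shape_form_lower_bound[of w "s - c"] s by (simp add: r_def)
  finally have h: "0 < h" .
  obtain u where u: "norm u = 1" "w = r *\<^sub>R axis_shape u"
    unfolding r_def by (rule axis_exists)
  obtain v where v: "norm v = 1" "u \<bullet> v = 0"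
    using orthogonal_unit_vector[OF u(1)] .
  define a where "a = sqrt (h / (1 - r))"
  define b where "b = sqrt (h / (1 + r))"
  have ab: "a\<^sup>2 = h / (1 - r)" "b\<^sup>2 = h / (1 + r)" "0 < b"
    using r h by (auto simp: a_def b_def)
  have "b \<le> a"
    unfolding a_def b_def using r h by (intro real_sqrt_le_mono divide_left_mono) auto
  have "(((x - c) \<bullet> u) / a)\<^sup>2 + (((x - c) \<bullet> v) / b)\<^sup>2 = shape_form w (x - c) / h" for x
  proof -
    have "shape_form w (x - c) = (1 - r) * ((x - c) \<bullet> u)\<^sup>2 + (1 + r) * ((x - c) \<bullet> v)\<^sup>2"
      unfolding u(2) by (rule shape_form_semiaxes[OF u(1) v])
    moreover have "X / (h / (1 - r)) + Y / (h / (1 + r)) = ((1 - r) * X + (1 + r) * Y) / h" for X Y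
      by (simp add: add_divide_distrib mult.commute)
    ultimately show ?thesis
      unfolding power_divide ab by simp
  qed
  then have "conic w l k = {p. (((p - c) \<bullet> u) / a)\<^sup>2 + (((p - c) \<bullet> v) / b)\<^sup>2 = 1}"
    unfolding C using h by auto
  then have E: "ellipse_with_semiaxes (conic w l k) a b"
    unfolding ellipse_with_semiaxes_def using u v ab \<open>b \<le> a\<close> by blast
  have "1 - b\<^sup>2 / a\<^sup>2 = 2 * r / (1 + r)"
  proof -
    have "b\<^sup>2 / a\<^sup>2 = (1 - r) / (1 + r)"
      unfolding ab using h by simp
    then show ?thesis
      using r by (simp add: diff_divide_eq_iff)
  qed
  then show ?thesis
    using E eccentricity_eq[OF E] by (auto simp: ellipse_def shape_eccentricity_def r_def)
qed

lemma ellipse_is_conic: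
  assumes "ellipse E"
  obtains w l k where "norm w < 1" "E = conic w l k"
proof -
  obtain a b c u v where ab: "b \<le> a" "0 < b" and uv: "norm u = 1" "norm v = 1" "u \<bullet> v = 0"
    and E: "E = {p. (((p - c) \<bullet> u) / a)\<^sup>2 + (((p - c) \<bullet> v) / b)\<^sup>2 = 1}"
    using assms unfolding ellipse_def ellipse_with_semiaxes_def by blast
  \<comment> \<open>Multiplying the equation in normal form by \<open>h\<close> turns the coefficients \<open>1 / a\<^sup>2\<close> and
    \<open>1 / b\<^sup>2\<close> into \<open>1 - r\<close> and \<open>1 + r\<close>, with sum 2.\<close>
  define r where "r = (a\<^sup>2 - b\<^sup>2) / (a\<^sup>2 + b\<^sup>2)"
  define h where "h = 2 * a\<^sup>2 * b\<^sup>2 / (a\<^sup>2 + b\<^sup>2)"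
  define w where "w = r *\<^sub>R axis_shape u"
  have pos: "a\<^sup>2 > 0" "b\<^sup>2 > 0" "b\<^sup>2 \<le> a\<^sup>2"
    using ab by (auto intro: power_mono)
  have ne: "a\<^sup>2 + b\<^sup>2 \<noteq> 0" "a\<^sup>2 \<noteq> 0" "b\<^sup>2 \<noteq> 0" "h \<noteq> 0"
    using pos by (auto simp: h_def add_nonneg_eq_0_iff)
  have "0 \<le> r" "r < 1"
    using pos unfolding r_def by (auto simp: divide_less_eq add_pos_pos)
  then have w1: "norm w < 1"
    using uv by (simp add: w_def norm_axis_shape)
  have "h * (X / a\<^sup>2 + Y / b\<^sup>2) = (1 - r) * X + (1 + r) * Y" for X Y
  proof -
    have eq: "1 - r = h / a\<^sup>2" "1 + r = h / b\<^sup>2"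
      unfolding r_def h_def using ne by (simp_all add: diff_divide_eq_iff add_divide_eq_iff)
    show ?thesis
      unfolding eq by (simp add: distrib_left)
  qed
  then have "shape_form w (p - c) = h * ((((p - c) \<bullet> u) / a)\<^sup>2 + (((p - c) \<bullet> v) / b)\<^sup>2)" for p
    unfolding w_def shape_form_semiaxes[OF uv] power_divide by simp
  then have "E = {p. shape_form w (p - c) = h}"
    unfolding E using ne by auto
  then have "E = conic w
     (vector [- 2 * ((1 + w$1) * c$1 + w$2 * c$2), - 2 * (w$2 * c$1 + (1 - w$1) * c$2)])
     (shape_form w c - h)"
    unfolding conic_def shape_form_translate by (auto simp: algebra_simps)
  then show ?thesis using that w1 by blast
qed

text \<open>
  Positive definiteness is invariant under scaling the equation; after scaling to trace 2, the
  determinant is \<open>1 - (norm w)\<^sup>2\<close>.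
\<close>
lemma positive_definite_conic:
  fixes \<alpha> \<beta> \<gamma> d e f :: real
  assumes "0 < \<alpha> + \<gamma>" "\<beta>\<^sup>2 < \<alpha> * \<gamma>"
  obtains w l k where "norm w < 1"
    "conic w l k = {p. \<alpha> * (p$1)\<^sup>2 + 2 * \<beta> * p$1 * p$2 + \<gamma> * (p$2)\<^sup>2 + d * p$1 + e * p$2 + f = 0}"
proof -
  define s where "s = (\<alpha> + \<gamma>) / 2"
  define w :: "real^2" where "w = vector [(\<alpha> - \<gamma>) / (2 * s), \<beta> / s]"
  define l :: "real^2" where "l = vector [d / s, e / s]"
  have s: "0 < s" using assms by (simp add: s_def)
  have w: "s * w$1 = (\<alpha> - \<gamma>) / 2" "s * w$2 = \<beta>" and l: "s * l$1 = d" "s * l$2 = e"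
    using s by (simp_all add: w_def l_def)
  have sums: "s + (\<alpha> - \<gamma>) / 2 = \<alpha>" "s - (\<alpha> - \<gamma>) / 2 = \<gamma>"
    by (simp_all add: s_def field_simps)
  have "(s * norm w)\<^sup>2 = ((\<alpha> - \<gamma>) / 2)\<^sup>2 + \<beta>\<^sup>2"
    unfolding power_mult_distrib norm_sq_2 distrib_left
    by (simp only: power_mult_distrib[symmetric] w)
  also have "\<dots> < s\<^sup>2"
  proof -
    have "\<alpha> * \<gamma> = (s + (\<alpha> - \<gamma>) / 2) * (s - (\<alpha> - \<gamma>) / 2)"
      unfolding sums ..
    also have "\<dots> = s\<^sup>2 - ((\<alpha> - \<gamma>) / 2)\<^sup>2"
      by (simp only: power2_eq_square square_diff_square_factored)
    finally show ?thesis
      using assms(2) by linarith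
  qed
  finally have "s * norm w < s * 1"
    using power2_less_imp_less[of "s * norm w" s] s by (metis less_imp_le mult_1_right)
  then have "norm w < 1"
    using s by (rule mult_less_cancel_left_pos[THEN iffD1, rotated])
  have scaled: "s * (shape_form w p + l \<bullet> p + f / s) =
     \<alpha> * (p$1)\<^sup>2 + 2 * \<beta> * p$1 * p$2 + \<gamma> * (p$2)\<^sup>2 + d * p$1 + e * p$2 + f" for p
  proof -
    have "s * (shape_form w p + l \<bullet> p + f / s) =
        (s + s * w$1) * (p$1)\<^sup>2 + 2 * (s * w$2) * p$1 * p$2 + (s - s * w$1) * (p$2)\<^sup>2
        + (s * l$1) * p$1 + (s * l$2) * p$2 + s * (f / s)"
      unfolding shape_form_def inner_2 by (simp only: power2_eq_square) (simp add: algebra_simps)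
    then show ?thesis
      unfolding w l sums using s by simp
  qed
  have "conic w l (f / s) =
    {p. \<alpha> * (p$1)\<^sup>2 + 2 * \<beta> * p$1 * p$2 + \<gamma> * (p$2)\<^sup>2 + d * p$1 + e * p$2 + f = 0}"
    unfolding conic_def scaled[symmetric] using s by simp
  with \<open>norm w < 1\<close> show ?thesis
    by (rule that)
qed

section \<open>An ellipse through four points in convex position\<close>

text \<open>
  Twice the signed area of the triangle \<open>a b p\<close>. For fixed \<open>a\<close> and \<open>b\<close> it is an affine function of
  \<open>p\<close> that vanishes on the line through \<open>a\<close> and \<open>b\<close>.
\<close>
definition signed_area :: "real^2 \<Rightarrow> real^2 \<Rightarrow> real^2 \<Rightarrow> real" where
  "signed_area a b p = (b$1 - a$1) * (p$2 - a$2) - (b$2 - a$2) * (p$1 - a$1)"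

lemma signed_area_segment:
  "signed_area a b ((1 - t) *\<^sub>R p + t *\<^sub>R q) = (1 - t) * signed_area a b p + t * signed_area a b q"
  unfolding signed_area_def by (simp add: algebra_simps)

lemma signed_area_self [simp]: "signed_area a b a = 0" "signed_area a b b = 0"
  by (simp_all add: signed_area_def)

lemma collinear_if_signed_area_0:
  assumes "signed_area a b p = 0"
  shows "collinear {a, b, p}"
proof (cases "a = b")
  case False
  define n where "n = (b - a) \<bullet> (b - a)"
  define t where "t = (p - a) \<bullet> (b - a)"
  have n: "n \<noteq> 0" using False by (simp add: n_def)
  have "n * (p - a)$1 = t * (b - a)$1" "n * (p - a)$2 = t * (b - a)$2"
    using assms unfolding n_def t_def inner_2 signed_area_def vector_minus_component by algebra+
  then have "p - a = (t / n) *\<^sub>R (b - a)"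
    using n by (simp add: vec_eq_iff forall_2 field_simps)
  then have "p = (1 - t / n) *\<^sub>R a + (t / n) *\<^sub>R b"
    by (simp add: algebra_simps)
  then have "p \<in> affine hull {a, b}"
    unfolding affine_hull_2_alt by (auto simp: algebra_simps)
  then show ?thesis
    by (metis collinear_3_affine_hull False insert_commute)
qed (simp add: collinear_2)

text \<open>Of three distinct collinear points, one lies strictly between the other two.\<close>
lemma not_collinear_extreme_points:
  assumes "a extreme_point_of R" "b extreme_point_of R" "p extreme_point_of R"
    and "a \<noteq> b" "a \<noteq> p" "b \<noteq> p"
  shows "signed_area a b p \<noteq> 0"
proof
  assume "signed_area a b p = 0"
  then have "between (b, p) a \<or> between (p, a) b \<or> between (a, b) p"
    using collinear_between_cases collinear_if_signed_area_0 by blast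
  then have "a \<in> open_segment b p \<or> b \<in> open_segment p a \<or> p \<in> open_segment a b"
    using assms(4-6) by (auto simp: between_mem_segment open_segment_def)
  then show False
    using assms(1-3) unfolding extreme_point_of_def by blast
qed

text \<open>
  Four points in the plane are affinely dependent, so by Radon's theorem they split into two parts
  whose convex hulls meet. No part can be a single point, as an extreme point of \<open>R\<close> is not in the
  convex hull of other points of \<open>R\<close>. So both parts have two points, and they are the diagonals.
\<close>
lemma convex_position_diagonals_cross:
  assumes R: "convex R" and V: "V \<subseteq> {x. x extreme_point_of R}" "card V = 4"
  obtains a b c d :: "real^2" where "V = {a, b, c, d}" "distinct [a, b, c, d]"
    "closed_segment a c \<inter> closed_segment b d \<noteq> {}"
proof -
  have fin: "finite V" using V(2) by (metis card.infinite zero_neq_numeral)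
  have "affine_dependent V"
    using affine_dependent_biggerset[OF fin] V(2) by simp
  from Radon_partition[OF fin this] obtain M P where MP: "M \<inter> P = {}" "M \<union> P = V"
    "convex hull M \<inter> convex hull P \<noteq> {}" by blast
  have card: "card M + card P = 4"
    using card_Un_disjoint[of M P] MP fin V(2) by (metis finite_Un)
  have one: "card A \<noteq> 1" if "A \<inter> B = {}" "A \<union> B = V" "convex hull A \<inter> convex hull B \<noteq> {}" for A B
  proof
    assume "card A = 1"
    then obtain x where A: "A = {x}" by (auto simp: card_1_singleton_iff)
    have x: "x extreme_point_of R" using that A V by auto
    have "B \<subseteq> R - {x}"
      using that A V by (auto simp: extreme_point_of_def)
    moreover have "convex (R - {x})"
      using x extreme_point_of_stillconvex[OF R] by blast
    ultimately have "convex hull B \<subseteq> R - {x}"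
      by (rule hull_minimal)
    then show False using that A by auto
  qed
  have "card M \<noteq> 0" "card P \<noteq> 0"
    using MP fin by (auto simp: card_eq_0_iff)
  moreover have "card M \<noteq> 1" "card P \<noteq> 1"
    using one[of M P] one[of P M] MP by (auto simp: Int_commute Un_commute)
  ultimately have "card M = 2" "card P = 2" using card by linarith+
  then obtain a b c d where "M = {a, c}" "a \<noteq> c" "P = {b, d}" "b \<noteq> d"
    unfolding card_2_iff by metis
  then show ?thesis
    using that[of a b c d] MP by (auto simp: segment_convex_hull)
qed

lemma opposite_sides:
  fixes x y :: real
  assumes "(1 - t) * x + t * y = 0" "0 \<le> t" "t \<le> 1" "x \<noteq> 0" "y \<noteq> 0"
  shows "x * y < 0"
proof (rule ccontr)
  assume "\<not> x * y < 0"
  then have "x * y > 0" using assms by (simp add: not_less less_le)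
  have "((1 - t) * x + t * y) * x = (1 - t) * x\<^sup>2 + t * (x * y)"
    by algebra
  moreover have "0 < (1 - t) * x\<^sup>2 + t * (x * y)"
  proof (cases "t = 0")
    case False
    then show ?thesis using assms \<open>x * y > 0\<close> by (intro add_nonneg_pos) auto
  qed (use assms in simp)
  ultimately show False using assms by simp
qed

text \<open>
  The signed areas \<open>m\<close> and \<open>n\<close> with respect to the two diagonals are oblique coordinates in which
  the diagonals are the axes. On the first axis, where \<open>n = 0\<close>, the points \<open>a\<close> and \<open>c\<close> are the zeros
  of \<open>\<kappa> (m - m a) (m - m c) = \<kappa> m\<^sup>2 - \<kappa> (m a + m c) m - 1\<close> for \<open>\<kappa> = - 1 / (m a * m c)\<close>, and \<open>\<kappa>\<close> is
  positive because \<open>a\<close> and \<open>c\<close> lie on opposite sides of the other diagonal. Likewise for \<open>n\<close>, \<open>b\<close> and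
  \<open>d\<close> with a factor \<open>\<mu>\<close>. Both polynomials have the constant term \<open>- 1\<close>, so a single polynomial without
  mixed term restricts to them on the axes, and its quadratic part \<open>\<kappa> m\<^sup>2 + \<mu> n\<^sup>2\<close> is positive definite.
\<close>
lemma ellipse_through_crossing_diagonals:
  assumes cross: "closed_segment a c \<inter> closed_segment b d \<noteq> {}"
    and ne: "signed_area b d a \<noteq> 0" "signed_area b d c \<noteq> 0"
      "signed_area a c b \<noteq> 0" "signed_area a c d \<noteq> 0"
  obtains w l k where "norm w < 1" "{a, b, c, d} \<subseteq> conic w l k"
proof -
  define m where "m = signed_area b d"
  define n where "n = signed_area a c"
  obtain t t' o' where t: "0 \<le> t" "t \<le> 1" "o' = (1 - t) *\<^sub>R a + t *\<^sub>R c"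
    and t': "0 \<le> t'" "t' \<le> 1" "o' = (1 - t') *\<^sub>R b + t' *\<^sub>R d"
    using cross unfolding closed_segment_def by blast
  have "m o' = (1 - t) * m a + t * m c" "m o' = 0"
    unfolding m_def by (simp only: t(3) signed_area_segment) (simp add: t'(3) signed_area_segment)
  moreover have "n o' = (1 - t') * n b + t' * n d" "n o' = 0"
    unfolding n_def by (simp only: t'(3) signed_area_segment) (simp add: t(3) signed_area_segment)
  ultimately have "(1 - t) * m a + t * m c = 0" "(1 - t') * n b + t' * n d = 0"
    by simp_all
  then have m: "m a * m c < 0" and n: "n b * n d < 0"
    using opposite_sides t(1,2) t'(1,2) ne unfolding m_def n_def by blast+
  define \<kappa> where "\<kappa> = - 1 / (m a * m c)"
  define \<mu> where "\<mu> = - 1 / (n b * n d)"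
  have pos: "0 < \<kappa>" "0 < \<mu>" and \<kappa>: "\<kappa> * (m a * m c) = - 1" and \<mu>: "\<mu> * (n b * n d) = - 1"
    using m n by (auto simp: \<kappa>_def \<mu>_def zero_less_divide_iff)
  \<comment> \<open>Coefficients of \<open>m\<close> and \<open>n\<close> in Cartesian coordinates, then those of the conic.\<close>
  define m1 m2 m0 where "m1 = b$2 - d$2" and "m2 = d$1 - b$1" and "m0 = m (0 :: real^2)"
  define n1 n2 n0 where "n1 = a$2 - c$2" and "n2 = c$1 - a$1" and "n0 = n (0 :: real^2)"
  have mp: "m p = m1 * p$1 + m2 * p$2 + m0" and np: "n p = n1 * p$1 + n2 * p$2 + n0" for p
    unfolding m_def n_def m1_def m2_def m0_def n1_def n2_def n0_def signed_area_def
    by (simp_all add: algebra_simps)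
  define \<alpha> \<beta> \<gamma> where "\<alpha> = \<kappa> * m1\<^sup>2 + \<mu> * n1\<^sup>2" and "\<beta> = \<kappa> * m1 * m2 + \<mu> * n1 * n2"
    and "\<gamma> = \<kappa> * m2\<^sup>2 + \<mu> * n2\<^sup>2"
  \<comment> \<open>The diagonals are not parallel: their cross product is \<open>m c - m a\<close>.\<close>
  have "m a \<noteq> m c"
    using m by (auto simp: not_square_less_zero)
  moreover have "m c - m a = m1 * n2 - m2 * n1"
    unfolding m_def signed_area_def m1_def m2_def n1_def n2_def by algebra
  ultimately have "0 < \<kappa> * \<mu> * (m1 * n2 - m2 * n1)\<^sup>2"
    using pos by simp
  also have "\<dots> = \<alpha> * \<gamma> - \<beta>\<^sup>2"
    unfolding \<alpha>_def \<beta>_def \<gamma>_def by algebra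
  finally have disc: "\<beta>\<^sup>2 < \<alpha> * \<gamma>" by simp
  have "0 \<le> \<alpha>" "0 \<le> \<gamma>"
    using pos by (simp_all add: \<alpha>_def \<gamma>_def)
  moreover have "\<alpha> \<noteq> 0"
    using disc by (metis mult_zero_left not_less zero_le_power2)
  ultimately have tr: "0 < \<alpha> + \<gamma>" by simp
  define e where "e = 2 * \<kappa> * m1 * m0 + 2 * \<mu> * n1 * n0 - \<kappa> * (m a + m c) * m1 - \<mu> * (n b + n d) * n1"
  define f where "f = 2 * \<kappa> * m2 * m0 + 2 * \<mu> * n2 * n0 - \<kappa> * (m a + m c) * m2 - \<mu> * (n b + n d) * n2"
  define g where "g = \<kappa> * m0\<^sup>2 + \<mu> * n0\<^sup>2 - \<kappa> * (m a + m c) * m0 - \<mu> * (n b + n d) * n0 - 1"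
  obtain w l k where w: "norm w < 1" and C: "conic w l k =
      {p. \<alpha> * (p$1)\<^sup>2 + 2 * \<beta> * p$1 * p$2 + \<gamma> * (p$2)\<^sup>2 + e * p$1 + f * p$2 + g = 0}"
    by (rule positive_definite_conic[OF tr disc])
  have "\<alpha> * (p$1)\<^sup>2 + 2 * \<beta> * p$1 * p$2 + \<gamma> * (p$2)\<^sup>2 + e * p$1 + f * p$2 + g =
      \<kappa> * (m p)\<^sup>2 - \<kappa> * (m a + m c) * m p + (\<mu> * (n p)\<^sup>2 - \<mu> * (n b + n d) * n p) - 1" for p
    unfolding \<alpha>_def \<beta>_def \<gamma>_def e_def f_def g_def mp[of p] np[of p] by algebra
  then have C': "conic w l k =
      {p. \<kappa> * (m p)\<^sup>2 - \<kappa> * (m a + m c) * m p + (\<mu> * (n p)\<^sup>2 - \<mu> * (n b + n d) * n p) - 1 = 0}"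
    unfolding C by simp
  have "m b = 0" "m d = 0" "n a = 0" "n c = 0"
    by (simp_all add: m_def n_def)
  then have "{a, b, c, d} \<subseteq> conic w l k"
    unfolding C' using \<kappa> \<mu> by (simp add: algebra_simps power2_eq_square)
  with w show ?thesis
    by (rule that)
qed

section \<open>The shapes of the conics through given points\<close>

text \<open>
  The equations of two conics of the same shape differ by an affine function, and an affine function
  that vanishes at three noncollinear points is zero.
\<close>
lemma conic_determined_by_shape:
  assumes "signed_area a b p \<noteq> 0"
    and "{a, b, p} \<subseteq> conic w l k" "{a, b, p} \<subseteq> conic w l' k'"
  shows "l = l'" "k = k'"
proof -
  have eq: "(l - l') \<bullet> x = k' - k" if "x \<in> {a, b, p}" for x
    using assms(2,3) that unfolding conic_def by (fastforce simp: inner_diff_left)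
  have "(l - l')$1 * signed_area a b p = 0" "(l - l')$2 * signed_area a b p = 0"
    using eq[of a] eq[of b] eq[of p] unfolding inner_2 signed_area_def by simp_all algebra+
  then show "l = l'" using assms(1) by (simp add: vec_eq_iff forall_2)
  then show "k = k'" using eq[of a] by simp
qed

definition circumscribed_shapes :: "(real^2) set \<Rightarrow> (real^2) set" where
  "circumscribed_shapes V = {w. \<exists>l k. V \<subseteq> conic w l k}"

text \<open>
  The equation of a conic is affine in \<open>(w, l, k)\<close>: its inhomogeneous term \<open>p \<bullet> p\<close> is preserved by
  combinations with coefficients of sum 1.
\<close>
lemma affine_circumscribed_shapes: "affine (circumscribed_shapes V)"
  unfolding affine_def
proof (intro ballI allI impI)
  fix w w' and s t :: real
  assume "w \<in> circumscribed_shapes V" "w' \<in> circumscribed_shapes V" and st: "s + t = 1"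
  then obtain l k l' k' where V: "V \<subseteq> conic w l k" "V \<subseteq> conic w' l' k'"
    unfolding circumscribed_shapes_def by blast
  have "shape_form (s *\<^sub>R w + t *\<^sub>R w') p + (s *\<^sub>R l + t *\<^sub>R l') \<bullet> p + (s * k + t * k') =
     s * (shape_form w p + l \<bullet> p + k) + t * (shape_form w' p + l' \<bullet> p + k')" for p
  proof -
    have "p \<bullet> p = s * (p \<bullet> p) + t * (p \<bullet> p)"
      using st by (metis distrib_right mult_1)
    then show ?thesis
      unfolding shape_form_def by (simp add: algebra_simps)
  qed
  then have "V \<subseteq> conic (s *\<^sub>R w + t *\<^sub>R w') (s *\<^sub>R l + t *\<^sub>R l') (s * k + t * k')"
    using V unfolding conic_def by (simp add: subset_iff)
  then show "s *\<^sub>R w + t *\<^sub>R w' \<in> circumscribed_shapes V"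
    unfolding circumscribed_shapes_def by blast
qed

section \<open>The ellipse of minimal eccentricity\<close>

theorem proposition1:
  fixes R :: "(real^2) set"
  assumes "convex_quadrilateral R"
    and "\<not> trapezoid R"
  shows "\<exists>!E. E \<in> circumscribed_ellipses R \<and>
           (\<forall>E' \<in> circumscribed_ellipses R. eccentricity E \<le> eccentricity E')"
proof -
  define S where "S = circumscribed_shapes (vertices R)"
  have "convex R" "card (vertices R) = 4"
    using assms(1) by (auto simp: convex_quadrilateral_def polytope_imp_convex)
  then obtain a b c d where V: "vertices R = {a, b, c, d}" and dist: "distinct [a, b, c, d]"
    and cross: "closed_segment a c \<inter> closed_segment b d \<noteq> {}"
    using convex_position_diagonals_cross[of R "vertices R"] by (metis vertices_def order_refl)
  have nc: "signed_area x y z \<noteq> 0" if "{x, y, z} \<subseteq> {a, b, c, d}" "x \<noteq> y" "x \<noteq> z" "y \<noteq> z" for x y z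
    using not_collinear_extreme_points[of x R y z] that V by (auto simp: vertices_def)
  obtain w0 l0 k0 where w0: "norm w0 < 1" "vertices R \<subseteq> conic w0 l0 k0"
  proof -
    have "signed_area b d a \<noteq> 0" "signed_area b d c \<noteq> 0" "signed_area a c b \<noteq> 0" "signed_area a c d \<noteq> 0"
      using dist by (intro nc; auto)+
    then show ?thesis
      using ellipse_through_crossing_diagonals[OF cross] that V by metis
  qed
  have ell: "conic w l k \<in> circumscribed_ellipses R \<and>
      eccentricity (conic w l k) = shape_eccentricity w"
    if "norm w < 1" "vertices R \<subseteq> conic w l k" for w l k
    using ellipse_conic[OF that(1), of a l k b] that(2) V dist
    by (auto simp: circumscribed_ellipses_def)
  have rep: "\<exists>w l k. norm w < 1 \<and> vertices R \<subseteq> conic w l k \<and> E = conic w l k \<and> w \<in> S"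
    if "E \<in> circumscribed_ellipses R" for E
    using that ellipse_is_conic unfolding circumscribed_ellipses_def S_def circumscribed_shapes_def
    by (metis (mono_tags, lifting) mem_Collect_eq)
  have aff: "affine S" unfolding S_def by (rule affine_circumscribed_shapes)
  have cl: "closed S" "convex S"
    using aff affine_closed affine_imp_convex by blast+
  have "w0 \<in> S" using w0 unfolding S_def circumscribed_shapes_def by blast
  define z where "z = closest_point S 0"
  have min: "norm z \<le> norm w" if "w \<in> S" for w
    using closest_point_exists[OF cl(1), of 0] that by (auto simp: z_def)
  have "z \<in> S"
    using closest_point_exists[OF cl(1), of 0] \<open>w0 \<in> S\<close> by (auto simp: z_def)
  then obtain l k where zV: "vertices R \<subseteq> conic z l k"
    unfolding S_def circumscribed_shapes_def by blast
  have z1: "norm z < 1"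
    using min[OF \<open>w0 \<in> S\<close>] w0 by simp
  show ?thesis
  proof (intro ex1I conjI ballI)
    show "conic z l k \<in> circumscribed_ellipses R"
      using ell[OF z1 zV] by blast
    show "eccentricity (conic z l k) \<le> eccentricity E" if "E \<in> circumscribed_ellipses R" for E
      using rep[OF that] ell ell[OF z1 zV] min by (auto simp: shape_eccentricity_le_iff)
    fix E
    assume E: "E \<in> circumscribed_ellipses R \<and>
      (\<forall>E' \<in> circumscribed_ellipses R. eccentricity E \<le> eccentricity E')"
    then obtain w l' k' where w: "norm w < 1" "vertices R \<subseteq> conic w l' k'" "E = conic w l' k'" "w \<in> S"
      using rep by blast
    have "norm w \<le> norm z"
      using E ell[OF w(1,2)] ell[OF z1 zV] w(3) by (metis shape_eccentricity_le_iff)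
    then have "w = z"
      unfolding z_def using closest_point_unique[OF cl(2,1) w(4), of 0] min unfolding z_def
      by (metis dist_0_norm order_trans)
    then show "E = conic z l k"
      using conic_determined_by_shape[of a b c z l k l' k'] nc[of a b c] dist V zV w(2,3) by auto
  qed
qed

end
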